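(* Let $\kappa\neq 0$ be a real constant, let $U\subseteq\mathbb R^2$ be a simply connected open set with coordinates $(x,y)$, and let $\mathbf r:U\to\mathbb R^3$ be a smooth Chebyshev-parameterised surface with Chebyshev angle $\omega$, $\sin\omega\neq0$, whose Gauss curvature $K$ and Schief curvature $\sigma$ satisfy $K+\kappa\sigma=0$ on $U$ (a concordant Chebyshev net). Let $\mathbf n$ be its unit normal, $h_{ij}$ the normalised second fundamental coefficients, let $\mathbf m:U\to\mathbb R^3$ be a vector potential with $$\mathbf m_x=(h_{12}-\kappa)\,\mathbf r_x-h_{11}\,\mathbf r_y,\qquad \mathbf m_y=h_{22}\,\mathbf r_x+(\kappa-h_{12})\,\mathbf r_y,$$ and let $\mathbf r^{+}=\mathbf r+\mathbf m/\kappa$, $\mathbf r^{-}=\mathbf r-\mathbf m/\kappa$ be the associated surfaces. Then: (i) $\mathbf r^+$ and $\mathbf r^-$ are regular (immersions) wherever $\sigma\neq0$ and $\sin\omega\neq 0$; (ii) $\mathbf r^+$ and $\mathbf r^-$ are pseudospherical of constant Gauss curvature $-\kappa^2$ (where regular); (iii) all three surfaces $\mathbf r^+,\mathbf r^-,\mathbf r$ have one and the same unit normal vector $\mathbf n(x,y)$ at the corresponding points $\mathbf r^+(x,y)$, $\mathbf r^-(x,y)$, $\mathbf r(x,y)$; (iv) the direction of $\partial/\partial x$ is an asymptotic direction for $\mathbf r^+$, and the direction of $\partial/\partial y$ is an asymptotic direction for $\mathbf r^-$.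
   Context: A Chebyshev-parameterised surface is an immersion $\mathbf r(x,y)$ whose first fundamental form is $dx^2+2\cos\omega\,dx\,dy+dy^2$, where $\omega(x,y)\in(0,\pi)$ is the angle between $\mathbf r_x$ and $\mathbf r_y$ (the Chebyshev angle). Put $\mathbf n=(\mathbf r_x\times\mathbf r_y)/\|\mathbf r_x\times\mathbf r_y\|$ and $$h_{11}=\frac{\mathbf r_{xx}\cdot\mathbf n}{\sin\omega},\quad h_{12}=\frac{\mathbf r_{xy}\cdot\mathbf n}{\sin\omega},\quad h_{22}=\frac{\mathbf r_{yy}\cdot\mathbf n}{\sin\omega}.$$ Then the Gauss curvature is $K=h_{11}h_{22}-h_{12}^2$. The Schief curvature of the net of coordinate curves is $\sigma=(\mathbf r_{xy}\cdot\mathbf n)/\|\mathbf r_x\times\mathbf r_y\|=h_{12}$. A net is called concordant if $K$ equals a real constant times $\sigma$. Under $K+\kappa\sigma=0$ the system for $\mathbf m$ is compatible, so $\mathbf m$ exists and is unique up to an additive constant vector. Saying that $\mathbf n$ is the normal vector of $\mathbf r^\pm$ means that $\mathbf n$ is orthogonal to $\mathbf r^\pm_x$ and $\mathbf r^\pm_y$. A direction $X$ is asymptotic for a surface with normal $\mathbf n$ if its second fundamental form satisfies $\mathrm{II}(X,X)=0$. Pseudospherical means of constant negative Gauss curvature. *)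

theory Defs
  imports "HOL-Analysis.Analysis"
begin

section \<open>Smooth maps and immersions\<close>

text \<open>The sets \<open>S\<close> below are meant to be open, since all derivatives are taken in the full
  neighbourhood filter.\<close>

primrec Ck_on :: "nat \<Rightarrow> 'a::real_normed_vector set \<Rightarrow> ('a \<Rightarrow> 'b::real_normed_vector) \<Rightarrow> bool" where
  "Ck_on 0 S f \<longleftrightarrow> continuous_on S f"
| "Ck_on (Suc k) S f \<longleftrightarrow>
     (\<forall>p\<in>S. f differentiable (at p)) \<and> (\<forall>v. Ck_on k S (\<lambda>p. frechet_derivative f (at p) v))"

definition smooth_on :: "'a::real_normed_vector set \<Rightarrow> ('a \<Rightarrow> 'b::real_normed_vector) \<Rightarrow> bool" where
  "smooth_on S f \<longleftrightarrow> (\<forall>k. Ck_on k S f)"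

definition regular_at :: "('a::real_normed_vector \<Rightarrow> 'b::real_normed_vector) \<Rightarrow> 'a \<Rightarrow> bool" where
  "regular_at f p \<longleftrightarrow> f differentiable (at p) \<and> inj (frechet_derivative f (at p))"

definition immersion_on :: "'a::real_normed_vector set \<Rightarrow> ('a \<Rightarrow> 'b::real_normed_vector) \<Rightarrow> bool" where
  "immersion_on S f \<longleftrightarrow> smooth_on S f \<and> (\<forall>p\<in>S. regular_at f p)"

section \<open>Parameterised surfaces\<close>

definition pdx :: "(real \<times> real \<Rightarrow> 'b::real_normed_vector) \<Rightarrow> real \<times> real \<Rightarrow> 'b" where
  "pdx f p = frechet_derivative f (at p) (1, 0)"

definition pdy :: "(real \<times> real \<Rightarrow> 'b::real_normed_vector) \<Rightarrow> real \<times> real \<Rightarrow> 'b" where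
  "pdy f p = frechet_derivative f (at p) (0, 1)"

definition unit_normal :: "(real \<times> real \<Rightarrow> real^3) \<Rightarrow> real \<times> real \<Rightarrow> real^3" where
  "unit_normal f p = cross3 (pdx f p) (pdy f p) /\<^sub>R norm (cross3 (pdx f p) (pdy f p))"

definition unit_normal_vector_at :: "real^3 \<Rightarrow> (real \<times> real \<Rightarrow> real^3) \<Rightarrow> real \<times> real \<Rightarrow> bool" where
  "unit_normal_vector_at N f p \<longleftrightarrow> norm N = 1 \<and> N \<bullet> pdx f p = 0 \<and> N \<bullet> pdy f p = 0"

text \<open>The first and second fundamental forms at \<open>p\<close> act on tangent vectors given by their
  components with respect to \<open>\<partial>/\<partial>x, \<partial>/\<partial>y\<close>.  The second form is taken with respect to an explicitly
  given normal vector \<open>N\<close>, so that it also makes sense at singular points of \<open>f\<close>.\<close>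

definition first_form ::
    "(real \<times> real \<Rightarrow> real^3) \<Rightarrow> real \<times> real \<Rightarrow> real \<times> real \<Rightarrow> real \<times> real \<Rightarrow> real" where
  "first_form f p X Y =
     fst X * fst Y * (pdx f p \<bullet> pdx f p)
     + (fst X * snd Y + snd X * fst Y) * (pdx f p \<bullet> pdy f p)
     + snd X * snd Y * (pdy f p \<bullet> pdy f p)"

definition second_form ::
    "(real \<times> real \<Rightarrow> real^3) \<Rightarrow> real^3 \<Rightarrow> real \<times> real \<Rightarrow> real \<times> real \<Rightarrow> real \<times> real \<Rightarrow> real" where
  "second_form f N p X Y =
     fst X * fst Y * (pdx (pdx f) p \<bullet> N)
     + (fst X * snd Y + snd X * fst Y) * (pdy (pdx f) p \<bullet> N)
     + snd X * snd Y * (pdy (pdy f) p \<bullet> N)"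

definition asymptotic_direction ::
    "(real \<times> real \<Rightarrow> real^3) \<Rightarrow> real^3 \<Rightarrow> real \<times> real \<Rightarrow> real \<times> real \<Rightarrow> bool" where
  "asymptotic_direction f N p X \<longleftrightarrow> X \<noteq> (0, 0) \<and> second_form f N p X X = 0"

definition gauss_curvature :: "(real \<times> real \<Rightarrow> real^3) \<Rightarrow> real \<times> real \<Rightarrow> real" where
  "gauss_curvature f p =
     (let e1 = (1, 0); e2 = (0, 1); I = first_form f p; II = second_form f (unit_normal f p) p
      in (II e1 e1 * II e2 e2 - (II e1 e2)\<^sup>2) / (I e1 e1 * I e2 e2 - (I e1 e2)\<^sup>2))"

definition pseudospherical_on :: "(real \<times> real) set \<Rightarrow> (real \<times> real \<Rightarrow> real^3) \<Rightarrow> real \<Rightarrow> bool" where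
  "pseudospherical_on S f c \<longleftrightarrow>
     immersion_on S f \<and> c < 0 \<and> (\<forall>p\<in>S. gauss_curvature f p = c)"

definition schief_curvature :: "(real \<times> real \<Rightarrow> real^3) \<Rightarrow> real \<times> real \<Rightarrow> real" where
  "schief_curvature f p =
     (pdy (pdx f) p \<bullet> unit_normal f p) / norm (cross3 (pdx f p) (pdy f p))"

section \<open>Chebyshev nets\<close>

definition chebyshev_surface ::
    "(real \<times> real) set \<Rightarrow> (real \<times> real \<Rightarrow> real^3) \<Rightarrow> (real \<times> real \<Rightarrow> real) \<Rightarrow> bool" where
  "chebyshev_surface U r \<omega> \<longleftrightarrow>
     immersion_on U r \<and>
     (\<forall>p\<in>U. 0 < \<omega> p \<and> \<omega> p < pi \<and>
        (\<forall>dx dy. first_form r p (dx, dy) (dx, dy) = dx\<^sup>2 + 2 * cos (\<omega> p) * dx * dy + dy\<^sup>2))"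

definition h11 :: "(real \<times> real \<Rightarrow> real^3) \<Rightarrow> (real \<times> real \<Rightarrow> real) \<Rightarrow> real \<times> real \<Rightarrow> real" where
  "h11 r \<omega> p = (pdx (pdx r) p \<bullet> unit_normal r p) / sin (\<omega> p)"

definition h12 :: "(real \<times> real \<Rightarrow> real^3) \<Rightarrow> (real \<times> real \<Rightarrow> real) \<Rightarrow> real \<times> real \<Rightarrow> real" where
  "h12 r \<omega> p = (pdy (pdx r) p \<bullet> unit_normal r p) / sin (\<omega> p)"

definition h22 :: "(real \<times> real \<Rightarrow> real^3) \<Rightarrow> (real \<times> real \<Rightarrow> real) \<Rightarrow> real \<times> real \<Rightarrow> real" where
  "h22 r \<omega> p = (pdy (pdy r) p \<bullet> unit_normal r p) / sin (\<omega> p)"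

definition vector_potential ::
    "real \<Rightarrow> (real \<times> real) set \<Rightarrow> (real \<times> real \<Rightarrow> real^3) \<Rightarrow> (real \<times> real \<Rightarrow> real) \<Rightarrow>
     (real \<times> real \<Rightarrow> real^3) \<Rightarrow> bool" where
  "vector_potential \<kappa> U r \<omega> m \<longleftrightarrow>
     (\<forall>p\<in>U. m differentiable (at p) \<and>
        pdx m p = (h12 r \<omega> p - \<kappa>) *\<^sub>R pdx r p - h11 r \<omega> p *\<^sub>R pdy r p \<and>
        pdy m p = h22 r \<omega> p *\<^sub>R pdx r p + (\<kappa> - h12 r \<omega> p) *\<^sub>R pdy r p)"

definition assoc_plus ::
    "real \<Rightarrow> (real \<times> real \<Rightarrow> real^3) \<Rightarrow> (real \<times> real \<Rightarrow> real^3) \<Rightarrow> real \<times> real \<Rightarrow> real^3" where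
  "assoc_plus \<kappa> r m p = r p + m p /\<^sub>R \<kappa>"

definition assoc_minus ::
    "real \<Rightarrow> (real \<times> real \<Rightarrow> real^3) \<Rightarrow> (real \<times> real \<Rightarrow> real^3) \<Rightarrow> real \<times> real \<Rightarrow> real^3" where
  "assoc_minus \<kappa> r m p = r p - m p /\<^sub>R \<kappa>"

end

theory Submission
  imports Defs
begin

text \<open>
  The partial derivatives of \<open>r\<^sup>+\<close> and \<open>r\<^sup>-\<close> are combinations of \<open>r\<^sub>x\<close> and \<open>r\<^sub>y\<close>, so both surfaces share
  the tangent planes of \<open>r\<close> and their second forms against \<open>n\<close> are linear in that of \<open>r\<close>, without
  differentiating the coefficients.  Under \<open>K = - \<kappa> \<sigma>\<close> the change-of-frame determinant is
  \<open>\<sigma> / \<kappa>\<close> for both, while their second forms have off-diagonal entry \<open>\<sigma> sin \<omega>\<close> and a vanishing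
  diagonal entry (the \<open>xx\<close> one for \<open>r\<^sup>+\<close>, the \<open>yy\<close> one for \<open>r\<^sup>-\<close>).  Hence the Gauss curvature is
  \<open>- (\<sigma> sin \<omega>)\<^sup>2 / ((\<sigma> / \<kappa>)\<^sup>2 sin\<^sup>2 \<omega>) = - \<kappa>\<^sup>2\<close>.  The \<open>xx\<close> entry for \<open>r\<^sup>+\<close> vanishes only thanks to
  \<open>r\<^sub>x\<^sub>y = r\<^sub>y\<^sub>x\<close>.
\<close>

section \<open>Calculus of smooth maps\<close>

text \<open>\<open>Ck_on\<close> recurses through directional derivatives, so the induction runs
  over all \<open>f\<close>; its content is the base case, where differentiability gives
  continuity.\<close>

lemma Ck_on_SucD:
  assumes "Ck_on (Suc k) S f"
  shows "Ck_on k S f"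
  using assms
proof (induction k arbitrary: f)
  case 0
  then show ?case
    by (simp add: differentiable_imp_continuous_on differentiable_at_imp_differentiable_on)
next
  case (Suc k)
  then show ?case
    by (metis Ck_on.simps(2))
qed

text \<open>Openness is essential: the Frechet derivative at a point of \<open>S\<close> sees a
  whole neighbourhood, and on a small one both maps coincide.\<close>

lemma Ck_on_cong:
  assumes "open S" "\<And>p. p \<in> S \<Longrightarrow> f p = g p" "Ck_on k S f"
  shows "Ck_on k S g"
  using assms(2,3)
proof (induction k arbitrary: f g)
  case 0
  then show ?case
    using continuous_on_cong by fastforce
next
  case (Suc k)
  have "g differentiable (at p)" if "p \<in> S" for p
  proof -
    have "(f has_derivative frechet_derivative f (at p)) (at p)"
      using Suc.prems(2) that by (simp flip: frechet_derivative_works)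
    from has_derivative_transform_within_open[OF this \<open>open S\<close> that Suc.prems(1)]
    show ?thesis
      by (rule differentiableI)
  qed
  moreover have "frechet_derivative f (at p) v = frechet_derivative g (at p) v" if "p \<in> S" for p v
    using Suc.prems frechet_derivative_transform_within_open[OF _ \<open>open S\<close> that, of f g]
    by (simp add: that)
  then have "Ck_on k S (\<lambda>p. frechet_derivative g (at p) v)" for v
    by (rule Suc.IH[of "\<lambda>p. frechet_derivative f (at p) v"])
      (use Suc.prems(2) in auto)
  ultimately show ?case
    by simp
qed

lemma Ck_on_SucI:
  assumes "open S"
    and der: "\<And>p. p \<in> S \<Longrightarrow> (f has_derivative D p) (at p)"
    and D: "\<And>v. Ck_on k S (\<lambda>p. D p v)"
  shows "Ck_on (Suc k) S f"
proof -
  have "Ck_on k S (\<lambda>p. frechet_derivative f (at p) v)" for v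
    by (rule Ck_on_cong[OF \<open>open S\<close> _ D[of v]]) (simp add: frechet_derivative_at[OF der, symmetric])
  then show ?thesis
    using differentiableI[OF der] by simp
qed

lemma Ck_on_const: "Ck_on k S (\<lambda>p. c)"
  by (induction k arbitrary: c) (auto)

lemma Ck_on_has_derivative:
  assumes "Ck_on (Suc k) S f" "p \<in> S"
  shows "(f has_derivative frechet_derivative f (at p)) (at p)"
  using assms by (simp add: frechet_derivative_works)

lemma Ck_on_add:
  assumes "open S" "Ck_on k S f" "Ck_on k S g"
  shows "Ck_on k S (\<lambda>p. f p + g p)"
  using assms(2,3)
proof (induction k arbitrary: f g)
  case 0
  then show ?case
    by (auto intro: continuous_on_add)
next
  case (Suc k)
  show ?case
  proof (rule Ck_on_SucI[OF \<open>open S\<close>])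
    fix p assume "p \<in> S"
    then show "((\<lambda>p. f p + g p) has_derivative
        (\<lambda>v. frechet_derivative f (at p) v + frechet_derivative g (at p) v)) (at p)"
      using Suc.prems by (intro has_derivative_add Ck_on_has_derivative)
  next
    show "Ck_on k S (\<lambda>p. frechet_derivative f (at p) v + frechet_derivative g (at p) v)" for v
      using Suc.prems by (intro Suc.IH) auto
  qed
qed

text \<open>The product rule leaves two products, each with one factor differentiated; the other
  factor drops one order by \<open>Ck_on_SucD\<close>. Bounded bilinearity covers scalar, inner and
  cross products at once.\<close>

lemma (in bounded_bilinear) Ck_on_prod:
  assumes "open S" "Ck_on k S f" "Ck_on k S g"
  shows "Ck_on k S (\<lambda>p. prod (f p) (g p))"
  using assms(2,3)
proof (induction k arbitrary: f g)
  case 0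
  then show ?case
    by (auto intro: continuous_on)
next
  case (Suc k)
  show ?case
  proof (rule Ck_on_SucI[OF \<open>open S\<close>])
    fix p assume "p \<in> S"
    then show "((\<lambda>p. prod (f p) (g p)) has_derivative
        (\<lambda>v. prod (f p) (frechet_derivative g (at p) v) + prod (frechet_derivative f (at p) v) (g p)))
        (at p)"
      using Suc.prems by (intro FDERIV Ck_on_has_derivative)
  next
    show "Ck_on k S (\<lambda>p. prod (f p) (frechet_derivative g (at p) v)
        + prod (frechet_derivative f (at p) v) (g p))" for v
      using Suc.prems Suc.prems[THEN Ck_on_SucD]
      by (intro Ck_on_add[OF \<open>open S\<close>] Suc.IH) simp_all
  qed
qed

text \<open>The derivative of the inverse is built from the inverse itself and the derivative of
  \<open>f\<close>, so the induction hypothesis one order lower suffices.\<close>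

lemma Ck_on_inverse:
  fixes f :: "'a::real_normed_vector \<Rightarrow> real"
  assumes "open S" "Ck_on k S f" "\<And>p. p \<in> S \<Longrightarrow> f p \<noteq> 0"
  shows "Ck_on k S (\<lambda>p. inverse (f p))"
  using assms(2)
proof (induction k)
  case 0
  then show ?case
    using assms(3) by (auto intro: continuous_on_inverse)
next
  case (Suc k)
  note mult = bounded_bilinear.Ck_on_prod[OF bounded_bilinear_mult \<open>open S\<close>]
  have inv: "Ck_on k S (\<lambda>p. inverse (f p))"
    by (rule Suc.IH[OF Ck_on_SucD[OF Suc.prems]])
  show ?case
  proof (rule Ck_on_SucI[OF \<open>open S\<close>])
    fix p assume "p \<in> S"
    \<comment> \<open>The sign is written as a constant factor so that closure under products and
      constants applies to the derivative.\<close>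
    then show "((\<lambda>p. inverse (f p)) has_derivative
        (\<lambda>v. (-1) * (inverse (f p) * frechet_derivative f (at p) v * inverse (f p)))) (at p)"
      using Deriv.has_derivative_inverse[OF assms(3) Ck_on_has_derivative[OF Suc.prems]] by simp
  next
    show "Ck_on k S (\<lambda>p. (-1) * (inverse (f p) * frechet_derivative f (at p) v * inverse (f p)))" for v
      using Suc.prems by (intro mult inv Ck_on_const) simp
  qed
qed

section \<open>Closure properties of smooth maps\<close>

lemma smooth_on_cong:
  "open S \<Longrightarrow> (\<And>p. p \<in> S \<Longrightarrow> f p = g p) \<Longrightarrow> smooth_on S f \<Longrightarrow> smooth_on S g"
  unfolding smooth_on_def by (blast intro: Ck_on_cong)

lemma smooth_on_const: "smooth_on S (\<lambda>p. c)"
  unfolding smooth_on_def by (simp add: Ck_on_const)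

lemma smooth_on_add:
  "open S \<Longrightarrow> smooth_on S f \<Longrightarrow> smooth_on S g \<Longrightarrow> smooth_on S (\<lambda>p. f p + g p)"
  unfolding smooth_on_def by (simp add: Ck_on_add)

lemma (in bounded_bilinear) smooth_on_prod:
  "open S \<Longrightarrow> smooth_on S f \<Longrightarrow> smooth_on S g \<Longrightarrow> smooth_on S (\<lambda>p. prod (f p) (g p))"
  unfolding smooth_on_def by (simp add: Ck_on_prod)

lemmas smooth_on_mult = bounded_bilinear.smooth_on_prod[OF bounded_bilinear_mult]
lemmas smooth_on_scaleR = bounded_bilinear.smooth_on_prod[OF bounded_bilinear_scaleR]
lemmas smooth_on_inner = bounded_bilinear.smooth_on_prod[OF bounded_bilinear_inner]
lemmas smooth_on_cross3 =
  bounded_bilinear.smooth_on_prod[OF bilinear_cross[unfolded bilinear_conv_bounded_bilinear]]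

lemma smooth_on_minus:
  assumes "open S" "smooth_on S f"
  shows "smooth_on S (\<lambda>p. - f p)"
  using smooth_on_scaleR[OF assms(1) smooth_on_const[of S "-1"] assms(2)] by simp

lemma smooth_on_diff:
  assumes "open S" "smooth_on S f" "smooth_on S g"
  shows "smooth_on S (\<lambda>p. f p - g p)"
  using smooth_on_add[OF assms(1,2) smooth_on_minus[OF assms(1,3)]] by simp

lemma smooth_on_divide:
  fixes f g :: "'a::real_normed_vector \<Rightarrow> real"
  assumes "open S" "smooth_on S f" "smooth_on S g" "\<And>p. p \<in> S \<Longrightarrow> g p \<noteq> 0"
  shows "smooth_on S (\<lambda>p. f p / g p)"
  unfolding divide_inverse
  using assms by (intro smooth_on_mult) (auto simp: smooth_on_def intro: Ck_on_inverse)

lemma smooth_on_imp_differentiable: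
  "smooth_on S f \<Longrightarrow> p \<in> S \<Longrightarrow> f differentiable (at p)"
  unfolding smooth_on_def by (metis Ck_on.simps(2))

lemma smooth_on_imp_continuous_on: "smooth_on S f \<Longrightarrow> continuous_on S f"
  unfolding smooth_on_def by (metis Ck_on.simps(1))

lemma smooth_on_frechet_derivative:
  "smooth_on S f \<Longrightarrow> smooth_on S (\<lambda>p. frechet_derivative f (at p) v)"
  unfolding smooth_on_def by (metis Ck_on.simps(2))

lemma smooth_on_subset:
  assumes "smooth_on T f" "S \<subseteq> T"
  shows "smooth_on S f"
proof -
  have "Ck_on k T f \<Longrightarrow> Ck_on k S f" for k
    using assms(2)
  proof (induction k arbitrary: f)
    case 0
    then show ?case
      by (auto intro: continuous_on_subset)
  qed auto
  then show ?thesis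
    using assms(1) by (simp add: smooth_on_def)
qed

lemma smooth_on_pdx: "smooth_on S f \<Longrightarrow> smooth_on S (pdx f)"
  unfolding pdx_def[abs_def] by (rule smooth_on_frechet_derivative)

lemma smooth_on_pdy: "smooth_on S f \<Longrightarrow> smooth_on S (pdy f)"
  unfolding pdy_def[abs_def] by (rule smooth_on_frechet_derivative)

section \<open>Maps of the plane and their partial derivatives\<close>

lemma frechet_derivative_eq_partials:
  assumes "f differentiable (at p)"
  shows "frechet_derivative f (at p) v = fst v *\<^sub>R pdx f p + snd v *\<^sub>R pdy f p"
proof -
  interpret linear "frechet_derivative f (at p)"
    by (rule linear_frechet_derivative[OF assms])
  have "v = fst v *\<^sub>R (1, 0) + snd v *\<^sub>R (0, 1)"
    by (simp add: prod_eq_iff)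
  then have "frechet_derivative f (at p) v = frechet_derivative f (at p) (fst v *\<^sub>R (1, 0) + snd v *\<^sub>R (0, 1))"
    by simp
  then show ?thesis
    unfolding add scale by (simp add: pdx_def pdy_def)
qed

text \<open>Every directional derivative is a fixed linear combination of the two partials. This
  serves the associated surfaces, since \<open>m\<close> is assumed only differentiable.\<close>

lemma smooth_on_partials:
  assumes S: "open S" and der: "\<And>p. p \<in> S \<Longrightarrow> f differentiable (at p)"
    and x: "smooth_on S (pdx f)" and y: "smooth_on S (pdy f)"
  shows "smooth_on S f"
proof -
  have "smooth_on S (\<lambda>p. fst v *\<^sub>R pdx f p + snd v *\<^sub>R pdy f p)" for v
    using S x y by (intro smooth_on_add smooth_on_scaleR smooth_on_const)
  then have "smooth_on S (\<lambda>p. frechet_derivative f (at p) v)" for v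
    by (rule smooth_on_cong[OF S, rotated])
      (simp add: frechet_derivative_eq_partials[OF der])
  then have "Ck_on (Suc k) S f" for k
    using der by (simp add: smooth_on_def)
  then show ?thesis
    unfolding smooth_on_def by (blast intro: Ck_on_SucD)
qed

section \<open>Symmetry of mixed partial derivatives\<close>

lemma has_derivative_partials:
  assumes "f differentiable (at p)"
  shows "(f has_derivative (\<lambda>v. fst v *\<^sub>R pdx f p + snd v *\<^sub>R pdy f p)) (at p)"
  using assms frechet_derivative_eq_partials[OF assms]
  by (metis (no_types, lifting) ext frechet_derivative_works)

lemma partials_unique:
  assumes "(f has_derivative D) (at p)"
  shows "pdx f p = D (1, 0)" "pdy f p = D (0, 1)"
  using frechet_derivative_at[OF assms] by (simp_all add: pdx_def pdy_def)

text \<open>The chain rule along a horizontal line turns the partial into an ordinary derivative,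
  ready for the mean value theorem.\<close>

lemma DERIV_pdx:
  fixes f :: "real \<times> real \<Rightarrow> real"
  assumes "f differentiable (at (s, t))"
  shows "((\<lambda>s. f (s, t)) has_real_derivative pdx f (s, t)) (at s)"
proof -
  have "((\<lambda>s. (s, t)) has_derivative (\<lambda>h. (h, 0))) (at s)"
    by (auto intro!: derivative_eq_intros)
  from has_derivative_compose[OF this has_derivative_partials[OF assms]]
  show ?thesis
    by (simp add: has_field_derivative_def mult.commute[of _ "pdx f (s, t)"])
qed

lemma DERIV_pdy:
  fixes f :: "real \<times> real \<Rightarrow> real"
  assumes "f differentiable (at (s, t))"
  shows "((\<lambda>t. f (s, t)) has_real_derivative pdy f (s, t)) (at t)"
proof -
  have "((\<lambda>t. (s, t)) has_derivative (\<lambda>h. (0, h))) (at t)"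
    by (auto intro!: derivative_eq_intros)
  from has_derivative_compose[OF this has_derivative_partials[OF assms]]
  show ?thesis
    by (simp add: has_field_derivative_def mult.commute[of _ "pdy f (s, t)"])
qed

text \<open>Both iterated mean values compute the same double difference of \<open>f\<close>.\<close>

lemma mixed_partials_agree_in_square:
  fixes f :: "real \<times> real \<Rightarrow> real"
  assumes f: "smooth_on U f" and h: "0 < h" and sq: "{a..a + h} \<times> {b..b + h} \<subseteq> U"
  obtains q q' where "q \<in> {a..a + h} \<times> {b..b + h}" "q' \<in> {a..a + h} \<times> {b..b + h}"
    "pdy (pdx f) q = pdx (pdy f) q'"
proof -
  let ?D = "f (a + h, b + h) - f (a + h, b) - (f (a, b + h) - f (a, b))"
  note diff = smooth_on_imp_differentiable[OF f subsetD[OF sq]]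
  note diffx = smooth_on_imp_differentiable[OF smooth_on_pdx[OF f] subsetD[OF sq]]
  note diffy = smooth_on_imp_differentiable[OF smooth_on_pdy[OF f] subsetD[OF sq]]
  have "\<exists>s>a. s < a + h \<and> ?D = (a + h - a) * (pdx f (s, b + h) - pdx f (s, b))"
    using h by (intro MVT2 DERIV_diff DERIV_pdx diff) auto
  then obtain s where s: "a < s" "s < a + h" "?D = h * (pdx f (s, b + h) - pdx f (s, b))"
    by auto
  have "\<exists>t>b. t < b + h \<and> pdx f (s, b + h) - pdx f (s, b) = (b + h - b) * pdy (pdx f) (s, t)"
    using h s by (intro MVT2 DERIV_pdy diffx) auto
  then obtain t where t: "b < t" "t < b + h" "?D = h * (h * pdy (pdx f) (s, t))"
    using s by auto
  \<comment> \<open>Regrouping the four corner values in \<open>?D\<close> lets the mean value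
    theorem act in the second variable first.\<close>
  have "\<exists>t>b. t < b + h \<and> (f (a + h, b + h) - f (a, b + h)) - (f (a + h, b) - f (a, b))
      = (b + h - b) * (pdy f (a + h, t) - pdy f (a, t))"
    using h by (intro MVT2 DERIV_diff DERIV_pdy diff) auto
  then obtain t' where t': "b < t'" "t' < b + h" "?D = h * (pdy f (a + h, t') - pdy f (a, t'))"
    by auto
  have "\<exists>s>a. s < a + h \<and> pdy f (a + h, t') - pdy f (a, t') = (a + h - a) * pdx (pdy f) (s, t')"
    using h t' by (intro MVT2 DERIV_pdx diffy) auto
  then obtain s' where s': "a < s'" "s' < a + h" "?D = h * (h * pdx (pdy f) (s', t'))"
    using t' by auto
  from t(3) s'(3) h have "pdy (pdx f) (s, t) = pdx (pdy f) (s', t')"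
    by simp
  then show thesis
    using s t s' t' by (intro that[of "(s, t)" "(s', t')"]) auto
qed

text \<open>On every small square with corner \<open>p\<close> the two mixed partials share a value,
  taken at possibly different points; continuity at \<open>p\<close> then forces equality
  there.\<close>

lemma mixed_partials_commute_real:
  fixes f :: "real \<times> real \<Rightarrow> real"
  assumes U: "open U" and f: "smooth_on U f" and p: "p \<in> U"
  shows "pdx (pdy f) p = pdy (pdx f) p"
proof (rule ccontr)
  obtain a b where ab: "p = (a, b)"
    by fastforce
  let ?e = "\<bar>pdx (pdy f) p - pdy (pdx f) p\<bar>"
  assume "\<not> ?thesis"
  then have e: "?e / 2 > 0"
    by simp
  have "isCont (pdx (pdy f)) p" "isCont (pdy (pdx f)) p"
    using f U p by (auto intro!: continuous_on_interior smooth_on_imp_continuous_on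
        smooth_on_pdx smooth_on_pdy simp: interior_open)
  then obtain d1 d2 where d1: "d1 > 0" "\<And>q. dist q p < d1 \<Longrightarrow> \<bar>pdx (pdy f) q - pdx (pdy f) p\<bar> < ?e / 2"
    and d2: "d2 > 0" "\<And>q. dist q p < d2 \<Longrightarrow> \<bar>pdy (pdx f) q - pdy (pdx f) p\<bar> < ?e / 2"
    using e unfolding continuous_at_eps_delta dist_real_def by metis
  obtain d3 where d3: "d3 > 0" "ball p d3 \<subseteq> U"
    using U p openE by blast
  \<comment> \<open>Points of the square are within \<open>2 * h\<close> of its corner, so dividing
    by 3 keeps them strictly inside all three radii.\<close>
  define h where "h = min d1 (min d2 d3) / 3"
  have h: "0 < h"
    using d1(1) d2(1) d3(1) by (simp add: h_def)
  have near: "dist q p < d1 \<and> dist q p < d2 \<and> dist q p < d3"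
    if "q \<in> {a..a + h} \<times> {b..b + h}" for q
  proof -
    have "dist q p \<le> dist (fst q) a + dist (snd q) b"
      unfolding ab dist_prod_def by (simp add: sqrt_sum_squares_le_sum)
    also have "\<dots> \<le> 2 * h"
      using that by (auto simp: dist_real_def)
    finally show ?thesis
      using h by (auto simp: h_def)
  qed
  then have "{a..a + h} \<times> {b..b + h} \<subseteq> U"
    using d3(2) by (auto simp: dist_commute subset_eq)
  from mixed_partials_agree_in_square[OF f h this]
  obtain q q' where q: "q \<in> {a..a + h} \<times> {b..b + h}" "q' \<in> {a..a + h} \<times> {b..b + h}"
    and eq: "pdy (pdx f) q = pdx (pdy f) q'" .
  \<comment> \<open>Both partials are within half the gap of their values at \<open>p\<close>;
    sharing a value would make the gap smaller than itself.\<close>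
  then show False
    using d1(2)[of q'] d2(2)[of q] near[OF q(1)] near[OF q(2)] by argo
qed

lemma partials_inner:
  fixes f :: "real \<times> real \<Rightarrow> 'b::real_inner"
  assumes "f differentiable (at p)"
  shows "pdx (\<lambda>q. f q \<bullet> c) p = pdx f p \<bullet> c" "pdy (\<lambda>q. f q \<bullet> c) p = pdy f p \<bullet> c"
  using partials_unique[OF has_derivative_inner_left[OF has_derivative_partials[OF assms]]]
  by simp_all

text \<open>Pairing with an arbitrary fixed vector reduces the claim to the scalar case.\<close>

lemma mixed_partials_commute:
  fixes f :: "real \<times> real \<Rightarrow> 'b::real_inner"
  assumes U: "open U" and f: "smooth_on U f" and p: "p \<in> U"
  shows "pdx (pdy f) p = pdy (pdx f) p"
proof -
  have "pdx (pdy f) p \<bullet> c = pdy (pdx f) p \<bullet> c" for c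
  proof -
    let ?g = "\<lambda>q. f q \<bullet> c"
    have g: "smooth_on U ?g"
      by (rule smooth_on_inner[OF U f smooth_on_const])
    have gx: "pdx ?g q = pdx f q \<bullet> c" and gy: "pdy ?g q = pdy f q \<bullet> c" if "q \<in> U" for q
      using partials_inner smooth_on_imp_differentiable[OF f that] by blast+
    have "pdx (pdy ?g) p = pdx (\<lambda>q. pdy f q \<bullet> c) p"
      unfolding pdx_def[of "pdy ?g"] pdx_def[of "\<lambda>q. pdy f q \<bullet> c"]
      by (rule fun_cong[OF frechet_derivative_transform_within_open[OF _ U p gy]])
        (rule smooth_on_imp_differentiable[OF smooth_on_pdy[OF g] p])
    moreover have "pdy (pdx ?g) p = pdy (\<lambda>q. pdx f q \<bullet> c) p"
      unfolding pdy_def[of "pdx ?g"] pdy_def[of "\<lambda>q. pdx f q \<bullet> c"]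
      by (rule fun_cong[OF frechet_derivative_transform_within_open[OF _ U p gx]])
        (rule smooth_on_imp_differentiable[OF smooth_on_pdx[OF g] p])
    ultimately show ?thesis
      using mixed_partials_commute_real[OF U g p]
        partials_inner(1)[OF smooth_on_imp_differentiable[OF smooth_on_pdy[OF f] p]]
        partials_inner(2)[OF smooth_on_imp_differentiable[OF smooth_on_pdx[OF f] p]]
      by simp
  qed
  then show ?thesis
    by (rule vector_eq_rdot[THEN iffD1, rule_format])
qed

section \<open>Surfaces with the tangent planes of a given surface\<close>

text \<open>Injectivity of the differential is linear independence of the two partials, which in
  space the cross product detects.\<close>

lemma regular_at_iff_cross3:
  assumes "f differentiable (at p)"
  shows "regular_at f p \<longleftrightarrow> cross3 (pdx f p) (pdy f p) \<noteq> 0"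
proof -
  interpret linear "frechet_derivative f (at p)"
    by (rule linear_frechet_derivative[OF assms])
  note D = frechet_derivative_eq_partials[OF assms]
  have inj: "inj (frechet_derivative f (at p)) \<longleftrightarrow>
      (\<forall>a b. a *\<^sub>R pdx f p + b *\<^sub>R pdy f p = 0 \<longrightarrow> a = 0 \<and> b = 0)"
    by (simp add: linear_injective_0[OF linear_axioms] D zero_prod_def)
  have "cross3 (pdx f p) (pdy f p) \<noteq> 0" if "inj (frechet_derivative f (at p))"
  proof
    assume "cross3 (pdx f p) (pdy f p) = 0"
    then consider "pdx f p = 0" | "pdy f p = 0" | c where "pdy f p = c *\<^sub>R pdx f p"
      unfolding cross_eq_0 collinear_lemma by blast
    then show False
      \<comment> \<open>The coefficients are those of a nontrivial relation in each collinear case: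
        a vanishing partial, or \<open>pdy f p\<close> a multiple of \<open>pdx f p\<close>.\<close>
      using that[unfolded inj, rule_format, of 1 0] that[unfolded inj, rule_format, of 0 1]
        that[unfolded inj, rule_format, of _ "-1"]
      by cases auto
  qed
  moreover have "a = 0 \<and> b = 0"
    if C: "cross3 (pdx f p) (pdy f p) \<noteq> 0" and ab: "a *\<^sub>R pdx f p + b *\<^sub>R pdy f p = 0" for a b
  proof -
    \<comment> \<open>Crossing the relation with one partial removes that partial and isolates the
      other coefficient.\<close>
    have "cross3 (a *\<^sub>R pdx f p + b *\<^sub>R pdy f p) (pdy f p) = a *\<^sub>R cross3 (pdx f p) (pdy f p)"
      "cross3 (pdx f p) (a *\<^sub>R pdx f p + b *\<^sub>R pdy f p) = b *\<^sub>R cross3 (pdx f p) (pdy f p)"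
      by (simp_all add: cross_add_left cross_add_right cross_mult_left cross_mult_right)
    then show ?thesis
      unfolding ab using C by (metis cross_zero_left cross_zero_right scaleR_eq_0_iff)
  qed
  ultimately show ?thesis
    unfolding regular_at_def inj using assms by blast
qed

text \<open>This is Lagrange's identity; it identifies the denominator of the Gauss
  curvature.\<close>

lemma norm_cross3_partials:
  "(norm (cross3 (pdx f p) (pdy f p)))\<^sup>2 =
     first_form f p (1, 0) (1, 0) * first_form f p (0, 1) (0, 1) - (first_form f p (1, 0) (0, 1))\<^sup>2"
  unfolding norm_cross by (simp add: first_form_def power2_norm_eq_inner)

lemma unit_normal_vector_at_unit_normal:
  assumes "cross3 (pdx f p) (pdy f p) \<noteq> 0"
  shows "unit_normal_vector_at (unit_normal f p) f p"
  using assms by (simp add: unit_normal_vector_at_def unit_normal_def dot_cross_self inner_commute)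

text \<open>A unit normal vector is determined up to sign, and the sign cancels in the Gauss curvature.\<close>

lemma gauss_curvature_eq_unit_normal_vector:
  assumes N: "unit_normal_vector_at N f p" and C: "cross3 (pdx f p) (pdy f p) \<noteq> 0"
  shows "gauss_curvature f p =
     (second_form f N p (1, 0) (1, 0) * second_form f N p (0, 1) (0, 1)
       - (second_form f N p (1, 0) (0, 1))\<^sup>2) / (norm (cross3 (pdx f p) (pdy f p)))\<^sup>2"
proof -
  let ?C = "cross3 (pdx f p) (pdy f p)"
  \<comment> \<open>\<open>N\<close> and \<open>?C\<close> are both orthogonal to the tangent plane,
    hence parallel; expanding the triple product once more gives the factor explicitly.\<close>
  have "cross3 N ?C = 0"
    using N by (simp add: Lagrange unit_normal_vector_at_def)
  then have "cross3 N (cross3 N ?C) = 0"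
    by simp
  then have CN: "?C = (N \<bullet> ?C) *\<^sub>R N"
    using N by (simp add: Lagrange[of N N] unit_normal_vector_at_def dot_square_norm)
  \<comment> \<open>This is the sign, plus or minus one, relating \<open>N\<close> to
    \<open>unit_normal f p\<close>.\<close>
  define s where "s = (N \<bullet> ?C) / norm ?C"
  have "norm ?C = \<bar>N \<bullet> ?C\<bar>"
    using arg_cong[OF CN, of norm] N by (simp add: unit_normal_vector_at_def)
  then have "(N \<bullet> ?C)\<^sup>2 = (norm ?C)\<^sup>2"
    by simp
  then have s: "s * s = 1"
    using C by (simp add: s_def power_divide flip: power2_eq_square)
  have n: "unit_normal f p = s *\<^sub>R N"
    unfolding unit_normal_def s_def by (subst CN) (simp add: divide_inverse mult.commute)
  have "second_form f (unit_normal f p) p X Y = s * second_form f N p X Y" for X Y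
    unfolding n second_form_def by (simp add: algebra_simps)
  then have "gauss_curvature f p =
     (s * second_form f N p (1, 0) (1, 0) * (s * second_form f N p (0, 1) (0, 1))
       - (s * second_form f N p (1, 0) (0, 1))\<^sup>2) / (norm ?C)\<^sup>2"
    unfolding gauss_curvature_def norm_cross3_partials by (simp add: Let_def)
  also have "s * second_form f N p (1, 0) (1, 0) * (s * second_form f N p (0, 1) (0, 1))
       - (s * second_form f N p (1, 0) (0, 1))\<^sup>2 =
     (s * s) * (second_form f N p (1, 0) (1, 0) * second_form f N p (0, 1) (0, 1)
       - (second_form f N p (1, 0) (0, 1))\<^sup>2)"
    by (simp add: power2_eq_square algebra_simps)
  finally show ?thesis
    by (simp add: s)
qed

text \<open>Differentiating the coefficients produces only multiples of \<open>X p\<close> and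
  \<open>Y p\<close>, which are orthogonal to \<open>N\<close>.\<close>

lemma partials_tangent_field:
  fixes X Y F :: "real \<times> real \<Rightarrow> real^3"
  assumes U: "open U" "p \<in> U" and F: "\<And>q. q \<in> U \<Longrightarrow> F q = a q *\<^sub>R X q + b q *\<^sub>R Y q"
    and a: "a differentiable (at p)" and b: "b differentiable (at p)"
    and X: "X differentiable (at p)" and Y: "Y differentiable (at p)"
    and N: "X p \<bullet> N = 0" "Y p \<bullet> N = 0"
  shows "pdx F p \<bullet> N = a p * (pdx X p \<bullet> N) + b p * (pdx Y p \<bullet> N)"
    and "pdy F p \<bullet> N = a p * (pdy X p \<bullet> N) + b p * (pdy Y p \<bullet> N)"
proof -
  let ?D = "\<lambda>f v. fst v *\<^sub>R pdx f p + snd v *\<^sub>R pdy f p"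
  have "((\<lambda>q. a q *\<^sub>R X q + b q *\<^sub>R Y q) has_derivative
      (\<lambda>v. (a p *\<^sub>R ?D X v + ?D a v *\<^sub>R X p) + (b p *\<^sub>R ?D Y v + ?D b v *\<^sub>R Y p))) (at p)"
    by (intro has_derivative_add has_derivative_scaleR has_derivative_partials a b X Y)
  then have "(F has_derivative
      (\<lambda>v. (a p *\<^sub>R ?D X v + ?D a v *\<^sub>R X p) + (b p *\<^sub>R ?D Y v + ?D b v *\<^sub>R Y p))) (at p)"
    by (rule has_derivative_transform_within_open[OF _ U]) (simp add: F)
  note der = partials_unique[OF this]
  show "pdx F p \<bullet> N = a p * (pdx X p \<bullet> N) + b p * (pdx Y p \<bullet> N)"
    by (simp add: der(1) inner_add_left N)
  show "pdy F p \<bullet> N = a p * (pdy X p \<bullet> N) + b p * (pdy Y p \<bullet> N)"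
    by (simp add: der(2) inner_add_left N)
qed

text \<open>Both \<open>pdx f\<close> and \<open>pdy f\<close> are tangent fields of
  \<open>r\<close>, so the previous lemma applies to each. The \<open>xx\<close> entry meets
  \<open>pdx (pdy r)\<close>, which symmetry turns into the mixed entry of \<open>r\<close>.\<close>

lemma second_form_frame:
  fixes r f :: "real \<times> real \<Rightarrow> real^3"
  assumes U: "open U" "p \<in> U" and r: "smooth_on U r"
    and fx: "\<And>q. q \<in> U \<Longrightarrow> pdx f q = a q *\<^sub>R pdx r q + b q *\<^sub>R pdy r q"
    and fy: "\<And>q. q \<in> U \<Longrightarrow> pdy f q = c q *\<^sub>R pdx r q + d q *\<^sub>R pdy r q"
    and abcd: "smooth_on U a" "smooth_on U b" "smooth_on U c" "smooth_on U d"
    and N: "pdx r p \<bullet> N = 0" "pdy r p \<bullet> N = 0"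
  shows "second_form f N p (1, 0) (1, 0) =
      a p * second_form r N p (1, 0) (1, 0) + b p * second_form r N p (1, 0) (0, 1)"
    and "second_form f N p (1, 0) (0, 1) =
      a p * second_form r N p (1, 0) (0, 1) + b p * second_form r N p (0, 1) (0, 1)"
    and "second_form f N p (0, 1) (0, 1) =
      c p * second_form r N p (1, 0) (0, 1) + d p * second_form r N p (0, 1) (0, 1)"
  using partials_tangent_field[where F = "pdx f" and a = a and b = b, OF U fx _ _ _ _ N]
    partials_tangent_field[where F = "pdy f" and a = c and b = d, OF U fy _ _ _ _ N]
    abcd[THEN smooth_on_imp_differentiable, OF U(2)]
    smooth_on_imp_differentiable[OF smooth_on_pdx[OF r] U(2)]
    smooth_on_imp_differentiable[OF smooth_on_pdy[OF r] U(2)]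
    mixed_partials_commute[OF U(1) r U(2)]
  by (simp_all add: second_form_def)

lemma cross3_frame:
  "cross3 (a *\<^sub>R X + b *\<^sub>R Y) (c *\<^sub>R X + d *\<^sub>R Y) = (a * d - b * c) *\<^sub>R cross3 X Y"
  by (simp add: cross3_simps)

text \<open>One argument for both associated surfaces: only the product of the diagonal entries is
  required to vanish, so either entry may be the zero one.\<close>

lemma pseudospherical_frame:
  fixes r f :: "real \<times> real \<Rightarrow> real^3"
  assumes U: "open U" and r: "immersion_on U r" and f: "\<And>q. q \<in> U \<Longrightarrow> f differentiable (at q)"
    and fx: "\<And>q. q \<in> U \<Longrightarrow> pdx f q = a q *\<^sub>R pdx r q + b q *\<^sub>R pdy r q"
    and fy: "\<And>q. q \<in> U \<Longrightarrow> pdy f q = c q *\<^sub>R pdx r q + d q *\<^sub>R pdy r q"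
    and abcd: "smooth_on U a" "smooth_on U b" "smooth_on U c" "smooth_on U d"
    and det: "\<And>q. q \<in> U \<Longrightarrow> \<kappa> * (a q * d q - b q * c q) = \<sigma> q"
    and diag: "\<And>q. q \<in> U \<Longrightarrow> second_form f (unit_normal r q) q (1, 0) (1, 0)
        * second_form f (unit_normal r q) q (0, 1) (0, 1) = 0"
    and off: "\<And>q. q \<in> U \<Longrightarrow> second_form f (unit_normal r q) q (1, 0) (0, 1)
        = \<sigma> q * norm (cross3 (pdx r q) (pdy r q))"
    and \<kappa>: "\<kappa> \<noteq> 0"
  shows "immersion_on {p \<in> U. \<sigma> p \<noteq> 0} f" "pseudospherical_on {p \<in> U. regular_at f p} f (- \<kappa>\<^sup>2)"
    and "\<And>p. p \<in> U \<Longrightarrow> unit_normal_vector_at (unit_normal r p) f p"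
proof -
  have sr: "smooth_on U r" and Cr: "\<And>q. q \<in> U \<Longrightarrow> cross3 (pdx r q) (pdy r q) \<noteq> 0"
    using r regular_at_iff_cross3 regular_at_def unfolding immersion_on_def by blast+
  have Cf: "cross3 (pdx f q) (pdy f q) = (\<sigma> q / \<kappa>) *\<^sub>R cross3 (pdx r q) (pdy r q)" if "q \<in> U" for q
  proof -
    have "a q * d q - b q * c q = \<sigma> q / \<kappa>"
      using det[OF that] \<kappa> by (simp add: field_simps)
    then show ?thesis
      unfolding fx[OF that] fy[OF that] cross3_frame by simp
  qed
  have reg: "regular_at f q \<longleftrightarrow> \<sigma> q \<noteq> 0" if "q \<in> U" for q
    using Cr Cf \<kappa> f that by (simp add: regular_at_iff_cross3)
  show normal: "unit_normal_vector_at (unit_normal r p) f p" if "p \<in> U" for p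
    using unit_normal_vector_at_unit_normal[OF Cr[OF that]]
    by (simp add: unit_normal_vector_at_def fx fy that inner_add_right)
  \<comment> \<open>Smoothness of \<open>f\<close> is recovered from its partials, which are smooth
    combinations of those of \<open>r\<close>.\<close>
  have "smooth_on U (pdx f)" "smooth_on U (pdy f)"
    by (rule smooth_on_cong[OF U sym[OF fx]] smooth_on_cong[OF U sym[OF fy]], assumption,
        intro smooth_on_add smooth_on_scaleR smooth_on_pdx smooth_on_pdy U sr abcd)+
  then have "smooth_on U f"
    using smooth_on_partials[OF U, of f] f by blast
  then show imm: "immersion_on {p \<in> U. \<sigma> p \<noteq> 0} f"
    unfolding immersion_on_def using reg by (auto intro: smooth_on_subset)
  have "gauss_curvature f p = - \<kappa>\<^sup>2" if "p \<in> U" "\<sigma> p \<noteq> 0" for p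
  proof -
    have "cross3 (pdx f p) (pdy f p) \<noteq> 0"
      using Cf Cr \<kappa> that by simp
    \<comment> \<open>The normal of \<open>r\<close> may be opposite to that of \<open>f\<close>,
      depending on the sign of \<open>\<sigma> p / \<kappa>\<close>, so the curvature is computed
      against the normal of \<open>r\<close>.\<close>
    from gauss_curvature_eq_unit_normal_vector[OF normal[OF that(1)] this]
    show ?thesis
      using that Cr[OF that(1)] \<kappa>
      by (simp add: diag off Cf power_mult_distrib power_divide)
  qed
  then show "pseudospherical_on {p \<in> U. regular_at f p} f (- \<kappa>\<^sup>2)"
    unfolding pseudospherical_on_def using imm \<kappa> by (auto simp: reg cong: conj_cong)
qed

section \<open>Chebyshev nets\<close>

text \<open>Polarisation: the quadratic form is evaluated on the two coordinate vectors and on their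
  sum.\<close>

lemma chebyshev_surface_first_form:
  assumes "chebyshev_surface U r \<omega>" "p \<in> U"
  shows "pdx r p \<bullet> pdx r p = 1" "pdy r p \<bullet> pdy r p = 1" "pdx r p \<bullet> pdy r p = cos (\<omega> p)"
proof -
  have I: "first_form r p (dx, dy) (dx, dy) = dx\<^sup>2 + 2 * cos (\<omega> p) * dx * dy + dy\<^sup>2" for dx dy
    using assms by (simp add: chebyshev_surface_def)
  show 1: "pdx r p \<bullet> pdx r p = 1" "pdy r p \<bullet> pdy r p = 1"
    using I[of 1 0] I[of 0 1] by (simp_all add: first_form_def)
  show "pdx r p \<bullet> pdy r p = cos (\<omega> p)"
    using I[of 1 1] by (simp add: first_form_def 1)
qed

text \<open>The square is 1 minus the squared cosine; the range of \<open>\<omega>\<close> selects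
  the nonnegative root.\<close>

lemma chebyshev_surface_norm_cross3:
  assumes "chebyshev_surface U r \<omega>" "p \<in> U"
  shows "norm (cross3 (pdx r p) (pdy r p)) = sin (\<omega> p)"
proof (rule power2_eq_imp_eq)
  show "(norm (cross3 (pdx r p) (pdy r p)))\<^sup>2 = (sin (\<omega> p))\<^sup>2"
    unfolding norm_cross unfolding power2_norm_eq_inner chebyshev_surface_first_form[OF assms]
    by (simp add: sin_squared_eq)
  show "0 \<le> sin (\<omega> p)"
    using assms by (auto simp: chebyshev_surface_def intro: sin_ge_zero less_imp_le)
qed simp

text \<open>\<open>\<omega>\<close> itself is not known to be smooth, but \<open>sin \<omega>\<close> enters only squared, as
  \<open>1 - (r\<^sub>x \<bullet> r\<^sub>y)\<^sup>2\<close>.\<close>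

lemma chebyshev_surface_smooth_coefficient:
  assumes U: "open U" and r: "chebyshev_surface U r \<omega>" and v: "smooth_on U v"
    and sin: "\<And>p. p \<in> U \<Longrightarrow> sin (\<omega> p) \<noteq> 0"
  shows "smooth_on U (\<lambda>p. (v p \<bullet> unit_normal r p) / sin (\<omega> p))"
proof (rule smooth_on_cong[OF U])
  let ?F = "\<lambda>p. pdx r p \<bullet> pdy r p"
  have sq: "1 - ?F p * ?F p = (sin (\<omega> p))\<^sup>2" if "p \<in> U" for p
    unfolding chebyshev_surface_first_form[OF r that] sin_squared_eq by (simp add: power2_eq_square)
  have "smooth_on U r"
    using r by (simp add: chebyshev_surface_def immersion_on_def)
  then show "smooth_on U (\<lambda>p. (v p \<bullet> cross3 (pdx r p) (pdy r p)) / (1 - ?F p * ?F p))"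
    using sin sq v U
    by (intro smooth_on_divide smooth_on_diff smooth_on_mult smooth_on_inner smooth_on_cross3
        smooth_on_const smooth_on_pdx smooth_on_pdy) auto
  show "(v p \<bullet> cross3 (pdx r p) (pdy r p)) / (1 - ?F p * ?F p) =
      (v p \<bullet> unit_normal r p) / sin (\<omega> p)" if "p \<in> U" for p
    unfolding sq[OF that] unit_normal_def chebyshev_surface_norm_cross3[OF r that]
    by (simp add: power2_eq_square divide_inverse)
qed

section \<open>The associated surfaces of a concordant Chebyshev net\<close>

theorem theorem8p2:
  fixes \<kappa> :: real
    and U :: "(real \<times> real) set"
    and r m :: "real \<times> real \<Rightarrow> real^3"
    and \<omega> :: "real \<times> real \<Rightarrow> real"
  assumes "\<kappa> \<noteq> 0"
    and "open U"
    and "simply_connected U"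
    and "chebyshev_surface U r \<omega>"
    and "\<forall>p\<in>U. sin (\<omega> p) \<noteq> 0"
    and "\<forall>p\<in>U. gauss_curvature r p + \<kappa> * schief_curvature r p = 0"
    and "vector_potential \<kappa> U r \<omega> m"
  shows
    "immersion_on {p \<in> U. schief_curvature r p \<noteq> 0 \<and> sin (\<omega> p) \<noteq> 0} (assoc_plus \<kappa> r m) \<and>
     immersion_on {p \<in> U. schief_curvature r p \<noteq> 0 \<and> sin (\<omega> p) \<noteq> 0} (assoc_minus \<kappa> r m) \<and>
     pseudospherical_on {p \<in> U. regular_at (assoc_plus \<kappa> r m) p} (assoc_plus \<kappa> r m) (- \<kappa>\<^sup>2) \<and>
     pseudospherical_on {p \<in> U. regular_at (assoc_minus \<kappa> r m) p} (assoc_minus \<kappa> r m) (- \<kappa>\<^sup>2) \<and>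
     (\<forall>p\<in>U. unit_normal_vector_at (unit_normal r p) (assoc_plus \<kappa> r m) p \<and>
            unit_normal_vector_at (unit_normal r p) (assoc_minus \<kappa> r m) p \<and>
            unit_normal_vector_at (unit_normal r p) r p) \<and>
     (\<forall>p\<in>U. asymptotic_direction (assoc_plus \<kappa> r m) (unit_normal r p) p (1, 0) \<and>
            asymptotic_direction (assoc_minus \<kappa> r m) (unit_normal r p) p (0, 1))"
proof -
  note \<kappa> = assms(1) and U = assms(2) and r = assms(4) and sin = assms(5)[rule_format]
  have r_imm: "immersion_on U r"
    using r by (simp add: chebyshev_surface_def)
  then have sr: "smooth_on U r" and Cr: "\<And>p. p \<in> U \<Longrightarrow> cross3 (pdx r p) (pdy r p) \<noteq> 0"
    using regular_at_iff_cross3 regular_at_def unfolding immersion_on_def by blast+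
  define H11 H12 H22 \<sigma> where H_def:
    "H11 = h11 r \<omega>" "H12 = h12 r \<omega>" "H22 = h22 r \<omega>" "\<sigma> = schief_curvature r"
  have H: "smooth_on U H11" "smooth_on U H12" "smooth_on U H22"
    unfolding H_def h11_def[abs_def] h12_def[abs_def] h22_def[abs_def]
    by (intro chebyshev_surface_smooth_coefficient[OF U r] smooth_on_pdx smooth_on_pdy sr sin;
        assumption)+
  have II: "second_form r (unit_normal r p) p (1, 0) (1, 0) = sin (\<omega> p) * H11 p"
    "second_form r (unit_normal r p) p (1, 0) (0, 1) = sin (\<omega> p) * H12 p"
    "second_form r (unit_normal r p) p (0, 1) (0, 1) = sin (\<omega> p) * H22 p" if "p \<in> U" for p
    using sin[OF that] by (simp_all add: second_form_def H_def h11_def h12_def h22_def)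
  have normal: "unit_normal_vector_at (unit_normal r p) r p" if "p \<in> U" for p
    by (rule unit_normal_vector_at_unit_normal[OF Cr[OF that]])
  note W = chebyshev_surface_norm_cross3[OF r]
  have \<sigma>: "\<sigma> p = H12 p" if "p \<in> U" for p
    by (simp add: H_def schief_curvature_def h12_def W that)
  \<comment> \<open>Concordance in terms of the coefficients: the area element is
    \<open>sin (\<omega> p)\<close>, so its square cancels in the Gauss curvature, and the Schief
    curvature is \<open>H12 p\<close>.\<close>
  have K: "H11 p * H22 p - H12 p * H12 p = - \<kappa> * H12 p" if "p \<in> U" for p
  proof -
    have "gauss_curvature r p = H11 p * H22 p - H12 p * H12 p"
      unfolding gauss_curvature_eq_unit_normal_vector[OF normal[OF that] Cr[OF that]] II[OF that]
        W[OF that]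
      using sin[OF that] by (simp add: field_simps power2_eq_square)
    then show ?thesis
      using assms(6)[rule_format, OF that] \<sigma>[OF that] by (simp add: H_def eq_neg_iff_add_eq_0)
  qed
  have m: "m differentiable (at p)"
    "pdx m p = (H12 p - \<kappa>) *\<^sub>R pdx r p - H11 p *\<^sub>R pdy r p"
    "pdy m p = H22 p *\<^sub>R pdx r p + (\<kappa> - H12 p) *\<^sub>R pdy r p" if "p \<in> U" for p
    using assms(7) that by (simp_all add: vector_potential_def H_def)
  let ?p = "assoc_plus \<kappa> r m" and ?m = "assoc_minus \<kappa> r m"
  have der: "(?p has_derivative (\<lambda>v. (fst v *\<^sub>R pdx r p + snd v *\<^sub>R pdy r p)
      + (fst v *\<^sub>R pdx m p + snd v *\<^sub>R pdy m p) /\<^sub>R \<kappa>)) (at p)"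
    "(?m has_derivative (\<lambda>v. (fst v *\<^sub>R pdx r p + snd v *\<^sub>R pdy r p)
      - (fst v *\<^sub>R pdx m p + snd v *\<^sub>R pdy m p) /\<^sub>R \<kappa>)) (at p)" if "p \<in> U" for p
    unfolding assoc_plus_def[abs_def] assoc_minus_def[abs_def]
    by (intro has_derivative_add has_derivative_diff has_derivative_scaleR_right
        has_derivative_partials m that smooth_on_imp_differentiable[OF sr])+
  note diff = der[THEN differentiableI]
  \<comment> \<open>Dividing by \<open>\<kappa>\<close> makes the \<open>\<kappa>\<close> terms of
    the potential cancel \<open>pdx r\<close> or \<open>pdy r\<close>, or double it, which is the
    source of the 2.\<close>
  have px: "pdx ?p p = (H12 p / \<kappa>) *\<^sub>R pdx r p + (- H11 p / \<kappa>) *\<^sub>R pdy r p"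
    and py: "pdy ?p p = (H22 p / \<kappa>) *\<^sub>R pdx r p + (2 - H12 p / \<kappa>) *\<^sub>R pdy r p"
    and mx: "pdx ?m p = (2 - H12 p / \<kappa>) *\<^sub>R pdx r p + (H11 p / \<kappa>) *\<^sub>R pdy r p"
    and my: "pdy ?m p = (- H22 p / \<kappa>) *\<^sub>R pdx r p + (H12 p / \<kappa>) *\<^sub>R pdy r p" if "p \<in> U" for p
    unfolding partials_unique[OF der(1)[OF that]] partials_unique[OF der(2)[OF that]] m[OF that]
    using \<kappa> by (simp_all add: vec_eq_iff field_simps)
  have coeff: "smooth_on U (\<lambda>p. H11 p / \<kappa>)" "smooth_on U (\<lambda>p. - H11 p / \<kappa>)"
    "smooth_on U (\<lambda>p. H22 p / \<kappa>)" "smooth_on U (\<lambda>p. - H22 p / \<kappa>)"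
    "smooth_on U (\<lambda>p. H12 p / \<kappa>)" "smooth_on U (\<lambda>p. 2 - H12 p / \<kappa>)"
    using \<kappa> by (intro smooth_on_divide smooth_on_diff smooth_on_minus smooth_on_const U H; simp)+
  have N: "pdx r p \<bullet> unit_normal r p = 0" "pdy r p \<bullet> unit_normal r p = 0" if "p \<in> U" for p
    using normal[OF that] by (simp_all add: unit_normal_vector_at_def inner_commute)
  note IIp = second_form_frame[OF U _ sr px py coeff(5,2,3,6) N, unfolded II]
  note IIm = second_form_frame[OF U _ sr mx my coeff(6,1,4,5) N, unfolded II]
  \<comment> \<open>The two contributions are opposite multiples of \<open>H11 p * H12 p\<close> for
    the first surface and of \<open>H22 p * H12 p\<close> for the second.\<close>
  have asym: "second_form ?p (unit_normal r p) p (1, 0) (1, 0) = 0"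
    "second_form ?m (unit_normal r p) p (0, 1) (0, 1) = 0" if "p \<in> U" for p
    by (simp_all add: IIp IIm II that)
  have off: "second_form ?p (unit_normal r p) p (1, 0) (0, 1) = \<sigma> p * norm (cross3 (pdx r p) (pdy r p))"
    "second_form ?m (unit_normal r p) p (1, 0) (0, 1) = \<sigma> p * norm (cross3 (pdx r p) (pdy r p))"
    if "p \<in> U" for p
  proof -
    \<comment> \<open>The entries are arranged to display the block
      \<open>H11 p * H22 p - H12 p * H12 p\<close>, which \<open>K\<close> replaces by
      \<open>- \<kappa> * H12 p\<close>.\<close>
    have "second_form ?p (unit_normal r p) p (1, 0) (0, 1)
        = - sin (\<omega> p) * (H11 p * H22 p - H12 p * H12 p) / \<kappa>"
      "second_form ?m (unit_normal r p) p (1, 0) (0, 1)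
        = sin (\<omega> p) * (2 * H12 p + (H11 p * H22 p - H12 p * H12 p) / \<kappa>)"
      using \<kappa> by (simp_all add: IIp IIm II that field_simps)
    then show "second_form ?p (unit_normal r p) p (1, 0) (0, 1) = \<sigma> p * norm (cross3 (pdx r p) (pdy r p))"
      "second_form ?m (unit_normal r p) p (1, 0) (0, 1) = \<sigma> p * norm (cross3 (pdx r p) (pdy r p))"
      using \<kappa> by (simp_all add: K \<sigma> W that)
  qed
  have det: "\<kappa> * (H12 p / \<kappa> * (2 - H12 p / \<kappa>) - - H11 p / \<kappa> * (H22 p / \<kappa>)) = \<sigma> p"
    "\<kappa> * ((2 - H12 p / \<kappa>) * (H12 p / \<kappa>) - H11 p / \<kappa> * (- H22 p / \<kappa>)) = \<sigma> p" if "p \<in> U" for p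
  proof -
    have "\<kappa> * (H12 p / \<kappa> * (2 - H12 p / \<kappa>) - - H11 p / \<kappa> * (H22 p / \<kappa>))
        = 2 * H12 p + (H11 p * H22 p - H12 p * H12 p) / \<kappa>"
      "\<kappa> * ((2 - H12 p / \<kappa>) * (H12 p / \<kappa>) - H11 p / \<kappa> * (- H22 p / \<kappa>))
        = 2 * H12 p + (H11 p * H22 p - H12 p * H12 p) / \<kappa>"
      using \<kappa> by (simp_all add: field_simps)
    then show "\<kappa> * (H12 p / \<kappa> * (2 - H12 p / \<kappa>) - - H11 p / \<kappa> * (H22 p / \<kappa>)) = \<sigma> p"
      "\<kappa> * ((2 - H12 p / \<kappa>) * (H12 p / \<kappa>) - H11 p / \<kappa> * (- H22 p / \<kappa>)) = \<sigma> p"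
      using \<kappa> by (simp_all add: K \<sigma> that)
  qed
  \<comment> \<open>The index lists select smoothness of the four frame coefficients in order; the
    open premise is the vanishing diagonal product, supplied later by \<open>asym\<close>.\<close>
  note plus = pseudospherical_frame[OF U r_imm diff(1) px py coeff(5,2,3,6) det(1) _ off(1) \<kappa>]
  note minus = pseudospherical_frame[OF U r_imm diff(2) mx my coeff(6,1,4,5) det(2) _ off(2) \<kappa>]
  have reg: "{p \<in> U. schief_curvature r p \<noteq> 0 \<and> sin (\<omega> p) \<noteq> 0} = {p \<in> U. \<sigma> p \<noteq> 0}"
    using sin by (auto simp: H_def)
  show ?thesis
    unfolding reg using plus minus normal
    by (simp add: asym asymptotic_direction_def)
qed

end
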